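(* Let $T$ be an $\mathbb{N}^\star$-valued random variable with $\mathbb{E}T<\infty$ and $\gcd\{k\ge 1:\mathbb{P}(T=k)>0\}=1$, let $\boldsymbol{\xi}=(\xi_i)_{i\ge0}$ be the undelayed renewal sequence with inter-arrival $T$, and let $(R_i)_{i\ge0}$ be i.i.d. copies of an $\mathbb{N}$-valued random variable $R$ with $\mathbb{P}(R=0)>0$, independent of $\boldsymbol{\xi}$. Put $\alpha_n:=\mathbb{P}(R\le n)$ for $n\ge0$, and let $\mathcal{A}$ be the coverage event. For $i\ge0$ let $q_i:=\mathbb{P}(T\ge i+2\mid T\ge i+1)$ and $q_i^\star:=\max_{n\le i}q_n$. If $$\sum_{j=1}^k\ \prod_{i=k}^{k+j-2} q^\star_i = o(k)\qquad (k\to\infty)$$ and $$\liminf_{n\to\infty}\, n(\mathbb{E}T)^{-1}(1-\alpha_n)>1,$$ then $\mathbb{P}(\mathcal{A})>0$.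
   Context: $\mathbb{N}=\{0,1,2,\ldots\}$ and $\mathbb{N}^\star=\{1,2,\ldots\}$. The undelayed renewal sequence $\boldsymbol{\xi}=(\xi_i)_{i\ge0}$ with inter-arrival $T$ is the binary process defined as follows: let $(T_k)_{k\ge1}$ be i.i.d. copies of $T$; set $\xi_0=1$, and for $i\ge1$ let $\xi_i=1$ if there exists $n\ge1$ with $\sum_{k=1}^nT_k=i$, and $\xi_i=0$ otherwise. For $i\ge0$ let $\mathcal{C}_i$ be the random integer interval $\mathcal{C}_i=\{i+1,\ldots,i+R_i\}$ if $\xi_i=1$ and $R_i\ge1$, and $\mathcal{C}_i=\emptyset$ if $\xi_i=0$ or $R_i=0$. The coverage event is $\mathcal{A}=\{\bigcup_{i\ge0}\mathcal{C}_i=\mathbb{N}^\star\}$. The maximum defining $q_i^\star$ is over integers $0\le n\le i$ for which $q_n$ is defined, i.e. $\mathbb{P}(T\ge n+1)>0$. Empty products equal $1$ (this occurs for $j=1$). *)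

theory Defs
  imports "HOL-Probability.Probability" "HOL-Library.Landau_Symbols"
begin

definition iid_copies ::
    "'a measure \<Rightarrow> nat set \<Rightarrow> (nat \<Rightarrow> 'a \<Rightarrow> nat) \<Rightarrow> ('a \<Rightarrow> nat) \<Rightarrow> bool" where
  "iid_copies M I Xs X \<longleftrightarrow>
     prob_space.indep_vars M (\<lambda>_. count_space UNIV) Xs I \<and>
     (\<forall>i\<in>I. distr M (count_space UNIV) (Xs i) = distr M (count_space UNIV) X)"

text \<open>The inter-arrival times are indexed by \<open>{1..}\<close>; the entry \<open>Ts 0\<close> is never used.\<close>

definition renewal :: "(nat \<Rightarrow> 'a \<Rightarrow> nat) \<Rightarrow> nat \<Rightarrow> 'a \<Rightarrow> nat" where
  "renewal Ts i \<omega> =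
     (if i = 0 \<or> (\<exists>n\<ge>1. (\<Sum>k=1..n. Ts k \<omega>) = i) then 1 else 0)"

definition covered :: "(nat \<Rightarrow> 'a \<Rightarrow> nat) \<Rightarrow> (nat \<Rightarrow> 'a \<Rightarrow> nat) \<Rightarrow> nat \<Rightarrow> 'a \<Rightarrow> nat set" where
  "covered \<xi> Rs i \<omega> = (if \<xi> i \<omega> = 1 \<and> Rs i \<omega> \<ge> 1 then {i + 1..i + Rs i \<omega>} else {})"

definition coverage_event ::
    "'a measure \<Rightarrow> (nat \<Rightarrow> 'a \<Rightarrow> nat) \<Rightarrow> (nat \<Rightarrow> 'a \<Rightarrow> nat) \<Rightarrow> 'a set" where
  "coverage_event M \<xi> Rs = {\<omega> \<in> space M. (\<Union>i. covered \<xi> Rs i \<omega>) = {1..}}"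

definition q :: "'a measure \<Rightarrow> ('a \<Rightarrow> nat) \<Rightarrow> nat \<Rightarrow> real" where
  "q M T i = \<P>(\<omega> in M. T \<omega> \<ge> i + 2 \<bar> T \<omega> \<ge> i + 1)"

text \<open>
  \<^const>\<open>cond_prob\<close> is \<open>0\<close> when the conditioning event is null, so the indices
  at which \<^const>\<open>q\<close> is not meaningful are excluded explicitly. The index \<open>0\<close> always
  qualifies when \<open>T \<ge> 1\<close>, so the maximum is over a nonempty finite set.
\<close>

definition q_star :: "'a measure \<Rightarrow> ('a \<Rightarrow> nat) \<Rightarrow> nat \<Rightarrow> real" where
  "q_star M T i = Max {q M T n |n. n \<le> i \<and> \<P>(\<omega> in M. T \<omega> \<ge> n + 1) > 0}"

end

theory Submission
  imports Defs
begin

text \<open>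
  Given the renewal process, the point \<open>n\<close> is left uncovered by the origins \<open>i < n\<close> with
  probability \<open>\<Prod>\<^bsub>i<n, \<xi>\<^sub>i=1\<^esub> a (n - i)\<close>, where \<open>a r = \<alpha> (r - 1)\<close> and \<open>a 0 = 1\<close>.
  The expectation \<open>f n\<close> of this product satisfies \<open>f n = a n * E f (n - T)\<close>, so it is
  dominated by any \<open>w\<close> with \<open>w 0 = 1\<close> and \<open>a n * E w (n - T) \<le> w n\<close>. If \<open>1 - \<alpha> n \<ge> c * E T / n\<close>
  eventually, with \<open>c > 1\<close>, then \<open>w n\<close> proportional to \<open>n powr (- s)\<close> works for \<open>1 < s < min c 2\<close>:
  to first order \<open>E w (n - T) \<approx> (1 + s * E T / n) * w n\<close>, and the error from large \<open>T\<close> is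
  harmless because the condition on \<open>q_star\<close> forces \<open>P (T \<ge> 2 * k) = o (P (T \<ge> k))\<close>, so that
  the tail of \<open>T\<close> decays faster than any power. Hence \<open>f\<close> is summable. Finally, the origin
  covers \<open>{1..K}\<close> by itself with positive probability, and for large \<open>K\<close> the union bound
  covers everything beyond \<open>K\<close> from the other origins.
\<close>

section \<open>Real analysis: cubic decay and a linear bound for powers\<close>

text \<open>Strong induction through \<open>k = n div 2\<close>: halving the argument gains a factor
  32, while \<open>n \<le> 3 * k\<close> makes the cubic bound lose at most 27. The constant 32 is
  chosen to exceed \<open>3 ^ 3\<close>.\<close>

lemma antimono_halving_imp_cubic_decay:
  fixes F :: "nat \<Rightarrow> real"
  assumes anti: "antimono F" and nonneg: "\<And>n. 0 \<le> F n"
    and halving: "\<forall>\<^sub>F k in sequentially. F (2 * k) \<le> F k / 32"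
  obtains C where "\<And>n. n \<ge> 1 \<Longrightarrow> F n \<le> C / real n ^ 3"
proof -
  obtain K0 where K0: "\<And>k. k \<ge> K0 \<Longrightarrow> F (2 * k) \<le> F k / 32"
    using halving by (auto simp: eventually_sequentially)
  define K where "K = max K0 1"
  have K: "K \<ge> 1" "\<And>k. k \<ge> K \<Longrightarrow> F (2 * k) \<le> F k / 32"
    using K0 by (auto simp: K_def)
  \<comment> \<open>This value makes the bound immediate below \<open>2 * K\<close>, where
    \<open>F n \<le> F 0\<close>.\<close>
  define C where "C = F 0 * real (2 * K) ^ 3"
  have C: "C \<ge> 0" by (simp add: C_def nonneg)
  have "F n \<le> C / real n ^ 3" if "n \<ge> 1" for n
    using that
  proof (induction n rule: less_induct)
    case (less n)
    show ?case
    proof (cases "n < 2 * K")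
      case True
      have "real n ^ 3 \<le> real (2 * K) ^ 3"
        using True by (intro power_mono) auto
      have "F n * real n ^ 3 \<le> F 0 * real (2 * K) ^ 3"
        using True anti by (intro mult_mono power_mono) (auto simp: nonneg antimono_def)
      with less.prems show ?thesis by (simp add: C_def field_simps)
    next
      case False
      define k where "k = n div 2"
      have k: "k \<ge> K" "k \<ge> 1" "k < n" "n \<le> 3 * k" "2 * k \<le> n"
        using False K(1) by (auto simp: k_def)
      have "F n \<le> F (2 * k)" using anti k by (auto simp: antimono_def)
      also have "\<dots> \<le> F k / 32" using K k by auto
      also have "\<dots> \<le> (C / real k ^ 3) / 32"
        using less.IH[of k] k by auto
      also have "\<dots> \<le> C / real n ^ 3"
      proof -
        have "real n ^ 3 \<le> (3 * real k) ^ 3"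
          using k(4) by (intro power_mono) auto
        then have "real n ^ 3 \<le> real k ^ 3 * 32"
          by (simp add: power_mult_distrib)
           (smt (verit) zero_le_power of_nat_0_le_iff)
        then have "C * real n ^ 3 \<le> C * (real k ^ 3 * 32)"
          using C by (intro mult_left_mono)
        with k less.prems show ?thesis by (simp add: field_simps)
      qed
      finally show ?thesis .
    qed
  qed
  then show ?thesis using that by blast
qed

text \<open>At 0 both sides equal 1 and the power has slope \<open>s\<close>, so a line of slope
  \<open>t > s\<close> dominates it just to the right of 0.\<close>

lemma powr_minus_le_linear_near_zero:
  fixes s t :: real
  assumes "s < t"
  obtains \<delta> where "0 < \<delta>" "\<delta> \<le> 1" "\<And>x. 0 \<le> x \<Longrightarrow> x < \<delta> \<Longrightarrow> (1 - x) powr (- s) \<le> 1 + t * x"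
proof -
  define f where "f = (\<lambda>x::real. 1 + t * x - (1 - x) powr (- s))"
  have "DERIV f 0 :> t - s"
    unfolding f_def by (auto intro!: derivative_eq_intros)
  then obtain d where d: "d > 0" "\<And>h. 0 < h \<Longrightarrow> h < d \<Longrightarrow> f 0 < f (0 + h)"
    using DERIV_pos_inc_right[of f "t - s" 0] assms by auto
  show ?thesis
  proof (rule that[of "min d 1"])
    show "(1 - x) powr (- s) \<le> 1 + t * x" if "0 \<le> x" "x < min d 1" for x
      using d(2)[of x] that by (cases "x = 0") (auto simp: f_def)
  qed (use d in auto)
qed

section \<open>Measurability of finite patterns in sequence space\<close>

lemma sets_PiM_finite_cylinder:
  fixes A :: "nat \<Rightarrow> nat set"
  defines "N \<equiv> PiM UNIV (\<lambda>_::nat. count_space (UNIV :: nat set))"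
  assumes "finite P"
  shows "{x. \<forall>i\<in>P. x i \<in> A i} \<in> sets N"
proof -
  have space: "space N = UNIV" by (simp add: N_def space_PiM)
  have comp: "{x. x i \<in> A i} \<in> sets N" for i
  proof -
    have [measurable]: "(\<lambda>x. x i) \<in> measurable N (count_space UNIV)"
      unfolding N_def by (rule measurable_component_singleton) simp
    have "(\<lambda>x. x i) -` A i \<inter> space N \<in> sets N"
      by (rule measurable_sets[where A = "count_space UNIV"]) auto
    then show ?thesis by (simp add: space vimage_def)
  qed
  have "{x. \<forall>i\<in>P. x i \<in> A i} = {x \<in> space N. \<forall>i\<in>P. x i \<in> A i}" by (simp add: space)
  also have "\<dots> \<in> sets N"
    using assms(2) comp by (intro sets.sets_Collect_finite_All) (simp_all add: space)
  finally show ?thesis .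
qed

lemma sets_PiM_finite_pattern:
  assumes "finite (J :: nat set)"
  shows "{x. {i \<in> J. x i = 1} = P} \<in> sets (PiM UNIV (\<lambda>_::nat. count_space (UNIV :: nat set)))"
proof (cases "P \<subseteq> J")
  case True
  then have "{x. {i \<in> J. x i = 1} = P} = {x. \<forall>i\<in>J. x i \<in> (if i \<in> P then {1::nat} else - {1})}"
    by (auto split: if_splits)
  then show ?thesis
    using sets_PiM_finite_cylinder[OF assms, of "\<lambda>i. if i \<in> P then {1} else - {1}"]
    by (simp only:)
next
  case False
  then have "{x. {i \<in> J. x i = (1::nat)} = P} = {}" by blast
  then show ?thesis by (simp only: sets.empty_sets)
qed

context prob_space
begin

section \<open>Tail of the inter-arrival time\<close>

lemma tail_le_q_star:
  assumes [measurable]: "T \<in> measurable M (count_space UNIV)"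
    and pos: "\<And>\<omega>. \<omega> \<in> space M \<Longrightarrow> T \<omega> \<ge> 1"
  shows "0 \<le> q_star M T i"
    and "\<P>(\<omega> in M. T \<omega> \<ge> i + 2) \<le> q_star M T i * \<P>(\<omega> in M. T \<omega> \<ge> i + 1)"
proof -
  let ?S = "{q M T n |n. n \<le> i \<and> \<P>(\<omega> in M. T \<omega> \<ge> n + 1) > 0}"
  have fin: "finite ?S" by simp
  have "{\<omega> \<in> space M. 1 \<le> T \<omega>} = space M" using pos by auto
  then have "\<P>(\<omega> in M. T \<omega> \<ge> 0 + 1) = 1" by (simp add: prob_space)
  then have "q M T 0 \<in> ?S" by fastforce
  moreover have "0 \<le> q M T 0" by (simp add: q_def cond_prob_def)
  ultimately show nn: "0 \<le> q_star M T i"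
    unfolding q_star_def using Max_ge[OF fin] by (meson order_trans)
  show "\<P>(\<omega> in M. T \<omega> \<ge> i + 2) \<le> q_star M T i * \<P>(\<omega> in M. T \<omega> \<ge> i + 1)"
  proof (cases "\<P>(\<omega> in M. T \<omega> \<ge> i + 1) > 0")
    case True
    then have "q M T i \<le> q_star M T i"
      unfolding q_star_def by (intro Max_ge[OF fin]) auto
    moreover have "{\<omega> \<in> space M. i + 2 \<le> T \<omega> \<and> i + 1 \<le> T \<omega>} = {\<omega> \<in> space M. i + 2 \<le> T \<omega>}"
      by auto
    then have "\<P>(\<omega> in M. T \<omega> \<ge> i + 2) = q M T i * \<P>(\<omega> in M. T \<omega> \<ge> i + 1)"
      using True by (simp add: q_def cond_prob_def)
    ultimately show ?thesis using True by (simp add: mult_right_mono)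
  next
    case False
    \<comment> \<open>A null conditioning event keeps the index \<open>i\<close> out of the maximum,
      but then the left tail is null as well and nonnegativity of \<open>q_star\<close>
      suffices.\<close>
    have "\<P>(\<omega> in M. T \<omega> \<ge> i + 2) \<le> \<P>(\<omega> in M. T \<omega> \<ge> i + 1)"
      by (intro finite_measure_mono) auto
    with False have "\<P>(\<omega> in M. T \<omega> \<ge> i + 2) \<le> 0" by linarith
    also have "\<dots> \<le> q_star M T i * \<P>(\<omega> in M. T \<omega> \<ge> i + 1)"
      using nn by simp
    finally show ?thesis .
  qed
qed

lemma tail_le_prod_q_star:
  assumes "T \<in> measurable M (count_space UNIV)" "\<And>\<omega>. \<omega> \<in> space M \<Longrightarrow> T \<omega> \<ge> 1"
  shows "\<P>(\<omega> in M. T \<omega> \<ge> k + m + 1)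
    \<le> (\<Prod>i=k..<k + m. q_star M T i) * \<P>(\<omega> in M. T \<omega> \<ge> k + 1)"
proof (induction m)
  case (Suc m)
  have "\<P>(\<omega> in M. T \<omega> \<ge> k + Suc m + 1) \<le> q_star M T (k + m) * \<P>(\<omega> in M. T \<omega> \<ge> k + m + 1)"
    using tail_le_q_star(2)[OF assms, of "k + m"] by simp
  also have "\<dots> \<le> q_star M T (k + m) *
      ((\<Prod>i=k..<k + m. q_star M T i) * \<P>(\<omega> in M. T \<omega> \<ge> k + 1))"
    by (intro mult_left_mono Suc tail_le_q_star(1)[OF assms])
  finally show ?case by (simp add: mult_ac)
qed simp

text \<open>With \<open>F\<close> the tail of \<open>T\<close>, averaging
  \<open>F (2 * k) \<le> F (k + j)\<close> over \<open>j\<close> in \<open>{1..k}\<close> and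
  bounding each \<open>F (k + j)\<close> by a product of \<open>q_star\<close> times
  \<open>F (k + 1)\<close> gives \<open>F (2 * k) = o (F k)\<close>. The ratio \<open>1 / 32\<close>
  then yields the cubic rate by iterated halving.\<close>

lemma cubic_tail_decay:
  assumes meas [measurable]: "T \<in> measurable M (count_space UNIV)"
    and pos: "\<And>\<omega>. \<omega> \<in> space M \<Longrightarrow> T \<omega> \<ge> 1"
    and small: "(\<lambda>k. \<Sum>j=1..k. \<Prod>i=k..k + j - 2. q_star M T i) \<in> o(\<lambda>k. real k)"
  obtains C where "\<And>n. n \<ge> 1 \<Longrightarrow> \<P>(\<omega> in M. T \<omega> \<ge> n) \<le> C / real n ^ 3"
proof -
  define F where "F n = \<P>(\<omega> in M. T \<omega> \<ge> n)" for n
  have anti: "antimono F"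
    unfolding F_def antimono_def by (auto intro!: finite_measure_mono)
  have F0: "0 \<le> F n" for n by (simp add: F_def)
  have "\<forall>\<^sub>F k in sequentially.
      norm (\<Sum>j=1..k. \<Prod>i=k..k + j - 2. q_star M T i) \<le> (1 / 32) * norm (real k)"
    using landau_o.smallD[OF small, of "1 / 32"] by simp
  moreover have "\<forall>\<^sub>F k in sequentially. k \<ge> (1::nat)" by (rule eventually_ge_at_top)
  ultimately have "\<forall>\<^sub>F k in sequentially. F (2 * k) \<le> F k / 32"
  proof eventually_elim
    case (elim k)
    have "real k * F (2 * k) = (\<Sum>j=1..k. F (2 * k))" by simp
    also have "\<dots> \<le> (\<Sum>j=1..k. F (k + j))"
      using anti by (intro sum_mono) (auto simp: antimono_def)
    also have "\<dots> \<le> (\<Sum>j=1..k. (\<Prod>i=k..k + j - 2. q_star M T i) * F (k + 1))"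
    proof (intro sum_mono)
      fix j assume j: "j \<in> {1..k}"
      \<comment> \<open>With \<open>k \<ge> 1\<close> and \<open>j \<ge> 1\<close> the truncated
        \<open>k + j - 2\<close> is a true subtraction, so the interval has \<open>j - 1\<close>
        elements and is empty for \<open>j = 1\<close>.\<close>
      then have "{k..k + j - 2} = {k..<k + (j - 1)}" using elim(2) by auto
      then show "F (k + j) \<le> (\<Prod>i=k..k + j - 2. q_star M T i) * F (k + 1)"
        using tail_le_prod_q_star[OF meas pos, of k "j - 1"] j by (simp add: F_def)
    qed
    also have "\<dots> = (\<Sum>j=1..k. \<Prod>i=k..k + j - 2. q_star M T i) * F (k + 1)"
      by (simp add: sum_distrib_right)
    also have "\<dots> \<le> (1 / 32) * real k * F k"
    proof (rule mult_mono)
      show "F (k + 1) \<le> F k" using anti by (auto simp: antimono_def)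
    qed (use elim(1) F0 in auto)
    finally show ?case using elim(2) by (simp add: field_simps)
  qed
  from antimono_halving_imp_cubic_decay[OF anti F0 this] that show ?thesis
    by (metis F_def)
qed

section \<open>A summable supersolution of the renewal recursion\<close>

text \<open>The witness is a power \<open>n powr (- s)\<close>, normalised to 1 at \<open>N\<close>
  and capped at 1 below. Up to \<open>N\<close> the inequality follows from
  \<open>a n \<le> 1\<close>. Beyond \<open>N\<close>, with \<open>x = c * \<mu> / n\<close>, the
  expectation exceeds \<open>w n\<close> by a factor of at most \<open>1 + x\<close>, while
  \<open>a n \<le> 1 - x\<close>, and \<open>(1 - x) * (1 + x) \<le> 1\<close>. Truncated
  subtraction gives an overshoot the value \<open>w 0 = 1\<close>.\<close>

lemma renewal_supersolution:
  fixes T :: "'a \<Rightarrow> nat" and a :: "nat \<Rightarrow> real" and c :: real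
  defines "\<mu> \<equiv> expectation (\<lambda>\<omega>. real (T \<omega>))"
  assumes meas [measurable]: "T \<in> measurable M (count_space UNIV)"
    and int: "integrable M (\<lambda>\<omega>. real (T \<omega>))" and \<mu>: "0 < \<mu>"
    and tail: "\<And>n. n \<ge> 1 \<Longrightarrow> \<P>(\<omega> in M. T \<omega> \<ge> n) \<le> C / real n ^ 3"
    and a: "\<And>n. 0 \<le> a n" "\<And>n. a n \<le> 1"
    and c: "1 < c" and ev: "\<forall>\<^sub>F n in sequentially. a n \<le> 1 - c * \<mu> / real n"
  obtains w :: "nat \<Rightarrow> real" where "w 0 = 1" "\<And>n. 0 \<le> w n" "\<And>n. w n \<le> 1" "summable w"
    "\<And>n. a n * expectation (\<lambda>\<omega>. w (n - T \<omega>)) \<le> w n"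
proof -
  \<comment> \<open>\<open>s > 1\<close> gives summability; \<open>s < 2\<close> makes the cubic
    tail negligible against \<open>n powr (- s) / n\<close>.\<close>
  obtain s where s: "1 < s" "s < min c 2" using dense[of 1 "min c 2"] c by auto
  \<comment> \<open>The gap \<open>t - s\<close> pays for linearising the power, the gap
    \<open>c - t\<close> for large jumps.\<close>
  obtain t where t: "s < t" "t < c" using dense[of s c] s by auto
  obtain \<delta> where \<delta>: "0 < \<delta>" "\<delta> \<le> 1"
    "\<And>x. 0 \<le> x \<Longrightarrow> x < \<delta> \<Longrightarrow> (1 - x) powr (- s) \<le> 1 + t * x"
    using powr_minus_le_linear_near_zero[OF t(1)] by metis
  have C0: "0 \<le> C"
    using order_trans[OF measure_nonneg tail[of 1]] by simp
  have "(\<lambda>n. C / \<delta> ^ 3 * real n powr (s - 2)) \<longlonglongrightarrow> C / \<delta> ^ 3 * 0"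
    using s by (intro tendsto_mult tendsto_const tendsto_neg_powr filterlim_real_sequentially) auto
  then have "\<forall>\<^sub>F n in sequentially. C / \<delta> ^ 3 * real n powr (s - 2) < (c - t) * \<mu>"
    using t \<mu> by (intro order_tendstoD(2)[where y = "C / \<delta> ^ 3 * 0"]) auto
  with ev have "\<forall>\<^sub>F n in sequentially. a n \<le> 1 - c * \<mu> / real n \<and>
      C / \<delta> ^ 3 * real n powr (s - 2) < (c - t) * \<mu>"
    by eventually_elim auto
  then obtain N0 where N0: "\<And>n. n \<ge> N0 \<Longrightarrow> a n \<le> 1 - c * \<mu> / real n"
     "\<And>n. n \<ge> N0 \<Longrightarrow> C / \<delta> ^ 3 * real n powr (s - 2) < (c - t) * \<mu>"
    unfolding eventually_sequentially by blast
  define N where "N = max N0 1"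
  have N: "N \<ge> 1" "N \<ge> N0" by (auto simp: N_def)
  define w where "w n = (if n \<le> N then 1 else (real n / real N) powr (- s))" for n
  have w0: "0 \<le> w n" for n by (simp add: w_def)
  have w1: "w n \<le> 1" for n
    using N s by (auto simp: w_def powr_minus_divide intro!: divide_le_eq_1[THEN iffD2] ge_one_powr_ge_zero)
  \<comment> \<open>The pure power bounds \<open>w\<close> on both sides of \<open>N\<close>, so
    \<open>w (n - T \<omega>)\<close> can be estimated without locating its argument.\<close>
  have w_le: "w n \<le> (real n / real N) powr (- s)" if "n \<ge> 1" for n
  proof (cases "n \<le> N")
    case True
    have "(real n / real N) powr s \<le> 1"
      using True that N s by (intro powr_le1) auto
    then show ?thesis using True that N by (simp add: w_def powr_minus_divide)
  qed (simp add: w_def)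
  have "summable w"
  proof (rule summable_comparison_test_ev)
    show "\<forall>\<^sub>F n in sequentially. norm (w n) \<le> real N powr s * real n powr (- s)"
      using eventually_ge_at_top[of 1]
    proof eventually_elim
      case (elim n)
      then show ?case using w_le[OF elim] w0[of n] N
        by (simp add: powr_divide powr_minus divide_simps)
    qed
    show "summable (\<lambda>n. real N powr s * real n powr (- s))"
      using s by (intro summable_mult) (simp add: summable_real_powr_iff)
  qed
  moreover have "a n * expectation (\<lambda>\<omega>. w (n - T \<omega>)) \<le> w n" for n
  proof (cases "n \<le> N")
    case True
    have "expectation (\<lambda>\<omega>. w (n - T \<omega>)) \<le> expectation (\<lambda>\<omega>. 1)"
      by (intro integral_mono integrable_const_bound[where B = 1]) (auto simp: w0 w1)
    then have "expectation (\<lambda>\<omega>. w (n - T \<omega>)) \<le> 1" by (simp add: prob_space)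
    moreover have "0 \<le> expectation (\<lambda>\<omega>. w (n - T \<omega>))" by (simp add: w0)
    ultimately have "a n * expectation (\<lambda>\<omega>. w (n - T \<omega>)) \<le> 1"
      using a[of n] by (intro mult_le_one)
    then show ?thesis using True by (simp add: w_def)
  next
    case False
    then have n: "n > N" "n \<ge> 1" "n \<ge> N0" "real n > 0" using N by auto
    define W where "W = (real n / real N) powr (- s)"
    have W0: "0 \<le> W" by (simp add: W_def)
    \<comment> \<open>Large jumps, where \<open>w\<close> is only bounded by 1. Smaller jumps lie in
      the range of the linear bound.\<close>
    define B where "B = {\<omega> \<in> space M. \<delta> * real n \<le> real (T \<omega>)}"
    have [measurable]: "B \<in> sets M" unfolding B_def by measurable
    have pw: "w (n - T \<omega>) \<le> W * (1 + t * (real (T \<omega>) / real n)) + indicator B \<omega>"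
      if "\<omega> \<in> space M" for \<omega>
    proof (cases "\<omega> \<in> B")
      case True
      have "0 \<le> W * (1 + t * (real (T \<omega>) / real n))"
        using W0 s t by (intro mult_nonneg_nonneg) auto
      with True w1[of "n - T \<omega>"] show ?thesis by simp
    next
      case False
      then have x: "real (T \<omega>) / real n < \<delta>" using that n by (simp add: B_def field_simps)
      with \<delta>(2) have "real (T \<omega>) / real n < 1" by linarith
      then have Tn: "T \<omega> < n" using n by (simp add: field_simps)
      have "w (n - T \<omega>) \<le> (real (n - T \<omega>) / real N) powr (- s)"
        using Tn by (intro w_le) auto
      also have "real (n - T \<omega>) / real N = real n / real N * (1 - real (T \<omega>) / real n)"
        using Tn n N by (simp add: of_nat_diff field_simps)
      also have "\<dots> powr (- s) = W * (1 - real (T \<omega>) / real n) powr (- s)"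
        unfolding W_def using Tn n N by (intro powr_mult)
      also have "\<dots> \<le> W * (1 + t * (real (T \<omega>) / real n))"
        using \<delta>(3)[of "real (T \<omega>) / real n"] x W0 by (intro mult_left_mono) auto
      finally show ?thesis using False by simp
    qed
    have int1: "integrable M (\<lambda>\<omega>. W * (1 + t * (real (T \<omega>) / real n)))"
      using int by simp
    have intB: "integrable M (indicat_real B)"
      by (intro integrable_real_indicator) (auto simp: less_top[symmetric])
    have "expectation (\<lambda>\<omega>. w (n - T \<omega>))
        \<le> expectation (\<lambda>\<omega>. W * (1 + t * (real (T \<omega>) / real n)) + indicator B \<omega>)"
    proof (intro integral_mono pw)
      show "integrable M (\<lambda>\<omega>. w (n - T \<omega>))"
        by (intro integrable_const_bound[where B = 1]) (auto simp: w0 w1)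
    qed (intro Bochner_Integration.integrable_add int1 intB)
    also have "\<dots> = W * (1 + t * (\<mu> / real n)) + prob B"
      unfolding Bochner_Integration.integral_add[OF int1 intB]
      using int by (simp add: \<mu>_def prob_space)
    also have "prob B \<le> W * ((c - t) * \<mu> / real n)"
    proof -
      define m where "m = nat \<lceil>\<delta> * real n\<rceil>"
      have dn: "0 < \<delta> * real n" using \<delta> n by simp
      have m: "m \<ge> 1" "\<delta> * real n \<le> real m" using dn by (auto simp: m_def) linarith+
      have "B \<subseteq> {\<omega> \<in> space M. m \<le> T \<omega>}" by (auto simp: B_def m_def nat_le_iff ceiling_le_iff)
      then have "prob B \<le> \<P>(\<omega> in M. T \<omega> \<ge> m)"
        by (intro finite_measure_mono) auto
      also have "\<dots> \<le> C / real m ^ 3" by (rule tail[OF m(1)])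
      also have "\<dots> \<le> C / (\<delta> * real n) ^ 3"
        using m dn C0 \<delta> n by (intro divide_left_mono power_mono mult_pos_pos zero_less_power) linarith+
      \<comment> \<open>Splitting the cube exposes \<open>n powr (- s)\<close>, which is at most
        \<open>W\<close> because \<open>N \<ge> 1\<close>, and a factor that tends to 0.\<close>
      also have "\<dots> = real n powr (- s) * (C / \<delta> ^ 3 * real n powr (s - 2)) / real n"
      proof -
        have "real n powr (- s) * real n powr (s - 2) = real n powr (- 2)"
          by (simp add: powr_add[symmetric])
        also have "\<dots> = 1 / real n ^ 2" using n by (simp add: powr_minus_divide)
        finally have *: "real n powr (- s) * real n powr (s - 2) = 1 / real n ^ 2" .
        have "real n powr (- s) * (C / \<delta> ^ 3 * real n powr (s - 2)) / real n
          = C / \<delta> ^ 3 / real n * (real n powr (- s) * real n powr (s - 2))" by simp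
        then show ?thesis unfolding * using n \<delta> by (simp add: power_mult_distrib field_simps power_numeral_reduce)
      qed
      also have "\<dots> \<le> W * ((c - t) * \<mu>) / real n"
      proof (rule divide_right_mono[OF mult_mono])
        show "real n powr (- s) \<le> W"
          unfolding W_def using n N s by (intro powr_mono2') (auto simp: field_simps)
        show "C / \<delta> ^ 3 * real n powr (s - 2) \<le> (c - t) * \<mu>"
          using N0(2)[OF n(3)] by simp
      qed (use W0 C0 \<delta> in auto)
      finally show ?thesis by simp
    qed
    also have "W * (1 + t * (\<mu> / real n)) + W * ((c - t) * \<mu> / real n) = W * (1 + c * \<mu> / real n)"
      using n by (simp add: field_simps)
    finally have E: "expectation (\<lambda>\<omega>. w (n - T \<omega>)) \<le> W * (1 + c * \<mu> / real n)" by simp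
    have "a n * expectation (\<lambda>\<omega>. w (n - T \<omega>)) \<le> a n * (W * (1 + c * \<mu> / real n))"
      by (intro mult_left_mono E a)
    also have "\<dots> \<le> (1 - c * \<mu> / real n) * (W * (1 + c * \<mu> / real n))"
      using W0 c \<mu> N0(1)[OF n(3)] by (intro mult_right_mono mult_nonneg_nonneg) auto
    also have "\<dots> = W * (1 - (c * \<mu> / real n)\<^sup>2)"
      by algebra
    also have "\<dots> \<le> W" using W0 by (simp add: mult_left_le)
    finally show ?thesis using n by (simp add: w_def W_def)
  qed
  ultimately show ?thesis using that[of w] w0 w1 by (auto simp: w_def)
qed

section \<open>Expected product along the renewal process\<close>

lemma distr_restrict_eq_PiM_iid:
  assumes iid: "iid_copies M I Xs X" and J: "J \<subseteq> I" "J \<noteq> {}"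
  shows "distr M (Pi\<^sub>M J (\<lambda>_. count_space UNIV)) (\<lambda>\<omega>. \<lambda>i\<in>J. Xs i \<omega>)
    = Pi\<^sub>M J (\<lambda>_. distr M (count_space UNIV) X)"
proof -
  have ind: "indep_vars (\<lambda>_. count_space UNIV) Xs J"
    using iid J(1) by (auto simp: iid_copies_def intro: indep_vars_subset)
  then have "random_variable (count_space UNIV) (Xs i)" if "i \<in> J" for i
    using that by (auto simp: indep_vars_def)
  with ind J(2) have "distr M (Pi\<^sub>M J (\<lambda>_. count_space UNIV)) (\<lambda>\<omega>. \<lambda>i\<in>J. Xs i \<omega>)
    = Pi\<^sub>M J (\<lambda>i. distr M (count_space UNIV) (Xs i))"
    by (subst (asm) indep_vars_iff_distr_eq_PiM') auto
  also have "\<dots> = Pi\<^sub>M J (\<lambda>_. distr M (count_space UNIV) X)"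
    using iid J(1) by (intro PiM_cong) (auto simp: iid_copies_def)
  finally show ?thesis .
qed

text \<open>A finite product of countable discrete spaces is again discrete.\<close>

lemma measurable_PiM_count_space_nat:
  assumes "finite (J :: nat set)"
  shows "f \<in> Pi\<^sub>M J (\<lambda>_. count_space (UNIV :: nat set)) \<rightarrow>\<^sub>M borel"
proof -
  have "Pi\<^sub>M J (\<lambda>_. count_space (UNIV :: nat set)) = count_space (PiE J (\<lambda>_. UNIV))"
    using assms by (intro count_space_PiM_finite) auto
  then show ?thesis by simp
qed

text \<open>The process \<open>m \<mapsto> (\<Prod>k<m. a (n - S\<^sub>k)) * w (n - S\<^sub>m)\<close> is a supermartingale
  because \<open>w\<close> is a supersolution of the renewal recursion; truncated subtraction
  freezes the argument at \<open>0\<close> once the renewal process has passed \<open>n\<close>.\<close>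

lemma nn_integral_renewal_supermartingale:
  fixes T :: "'a \<Rightarrow> nat" and a w :: "nat \<Rightarrow> real" and m n :: nat
  assumes meas [measurable]: "T \<in> measurable M (count_space UNIV)"
    and a: "\<And>n. 0 \<le> a n" and w: "\<And>n. 0 \<le> w n" "\<And>n. w n \<le> 1"
    and super: "\<And>n. a n * expectation (\<lambda>\<omega>. w (n - T \<omega>)) \<le> w n"
  shows "(\<integral>\<^sup>+x. ennreal ((\<Prod>k<m. a (n - (\<Sum>i=1..k. x i))) * w (n - (\<Sum>i=1..m. x i)))
      \<partial>Pi\<^sub>M {1..m} (\<lambda>_. distr M (count_space UNIV) T)) \<le> ennreal (w n)"
proof (induction m)
  case 0
  then show ?case by (simp add: PiM_empty)
next
  case (Suc m)
  let ?D = "distr M (count_space UNIV) T"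
  interpret D: prob_space ?D by (rule prob_space_distr) simp
  interpret P: product_sigma_finite "\<lambda>_::nat. ?D" by standard
  define S where "S k x = (\<Sum>i=1..k. x i)" for k and x :: "nat \<Rightarrow> nat"
  have sets: "sets (Pi\<^sub>M J (\<lambda>_. ?D)) = sets (Pi\<^sub>M J (\<lambda>_. count_space UNIV))" for J :: "nat set"
    by (intro sets_PiM_cong) auto
  have mb: "f \<in> borel_measurable (Pi\<^sub>M J (\<lambda>_. ?D))" if "finite J"
    for J :: "nat set" and f :: "_ \<Rightarrow> ennreal"
    using measurable_PiM_count_space_nat[OF that, of f] by (simp cong: measurable_cong_sets add: sets)
  have S_upd: "S k (x(Suc m := y)) = S k x" if "k \<le> m" for k x y
    unfolding S_def using that by (intro sum.cong) auto
  have "(\<integral>\<^sup>+x. ennreal ((\<Prod>k<Suc m. a (n - S k x)) * w (n - S (Suc m) x)) \<partial>Pi\<^sub>M {1..Suc m} (\<lambda>_. ?D))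
     = (\<integral>\<^sup>+x. \<integral>\<^sup>+y. ennreal ((\<Prod>k<Suc m. a (n - S k (x(Suc m := y)))) * w (n - S (Suc m) (x(Suc m := y))))
           \<partial>?D \<partial>Pi\<^sub>M {1..m} (\<lambda>_. ?D))"
  proof -
    \<comment> \<open>Fubini with the last inter-arrival time innermost: given the earlier ones, it
      is the jump to which \<open>super\<close> applies.\<close>
    have "{1..Suc m} = insert (Suc m) {1..m}" by auto
    then show ?thesis by (simp only:) (rule P.product_nn_integral_insert; simp add: mb)
  qed
  also have "\<dots> \<le> (\<integral>\<^sup>+x. ennreal ((\<Prod>k<m. a (n - S k x)) * w (n - S m x)) \<partial>Pi\<^sub>M {1..m} (\<lambda>_. ?D))"
  proof (rule nn_integral_mono)
    fix x
    define p where "p = (\<Prod>k<m. a (n - S k x))"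
    have p: "0 \<le> p" unfolding p_def by (intro prod_nonneg) (simp add: a)
    have "(\<Prod>k<Suc m. a (n - S k (x(Suc m := y)))) = p * a (n - S m x)" for y
      unfolding p_def by (simp add: S_upd)
    \<comment> \<open>Truncated subtraction still satisfies \<open>n - (u + v) = n - u - v\<close>,
      so \<open>super\<close> is used at \<open>n - S m x\<close> even once the sums have passed
      \<open>n\<close>.\<close>
    moreover have "n - S (Suc m) (x(Suc m := y)) = n - S m x - y" for y
      using S_upd[of m x y] by (simp add: S_def)
    ultimately have "(\<integral>\<^sup>+y. ennreal ((\<Prod>k<Suc m. a (n - S k (x(Suc m := y)))) * w (n - S (Suc m) (x(Suc m := y)))) \<partial>?D)
      = (\<integral>\<^sup>+y. ennreal (p * a (n - S m x)) * ennreal (w (n - S m x - y)) \<partial>?D)"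
      using p a w by (simp add: ennreal_mult)
    also have "\<dots> = ennreal (p * a (n - S m x)) * (\<integral>\<^sup>+\<omega>. ennreal (w (n - S m x - T \<omega>)) \<partial>M)"
      by (simp add: nn_integral_cmult nn_integral_distr)
    also have "(\<integral>\<^sup>+\<omega>. ennreal (w (n - S m x - T \<omega>)) \<partial>M) = ennreal (expectation (\<lambda>\<omega>. w (n - S m x - T \<omega>)))"
      using w by (intro nn_integral_eq_integral integrable_const_bound[where B = 1]) auto
    also have "ennreal (p * a (n - S m x)) * \<dots> =
        ennreal (p * (a (n - S m x) * expectation (\<lambda>\<omega>. w (n - S m x - T \<omega>))))"
      using p a w by (simp add: ennreal_mult'[symmetric] mult.assoc)
    also have "\<dots> \<le> ennreal (p * w (n - S m x))"
      using p super by (intro ennreal_leI mult_left_mono)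
    finally show "(\<integral>\<^sup>+y. ennreal ((\<Prod>k<Suc m. a (n - S k (x(Suc m := y)))) * w (n - S (Suc m) (x(Suc m := y)))) \<partial>?D)
      \<le> ennreal ((\<Prod>k<m. a (n - S k x)) * w (n - S m x))"
      unfolding p_def .
  qed
  also have "\<dots> \<le> ennreal (w n)" using Suc by (simp add: S_def)
  finally show ?case by (simp add: S_def)
qed

text \<open>The copies share only the law of \<open>T\<close>, so its pointwise bound passes to them
  almost surely, simultaneously for countably many indices.\<close>

lemma AE_iid_copies_ge_1:
  assumes meas [measurable]: "T \<in> measurable M (count_space UNIV)"
    and pos: "\<And>\<omega>. \<omega> \<in> space M \<Longrightarrow> T \<omega> \<ge> (1::nat)"
    and iid: "iid_copies M {1..} Ts T"
  shows "AE \<omega> in M. \<forall>k\<ge>1. 1 \<le> Ts k \<omega>"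
proof -
  have "AE \<omega> in M. 1 \<le> k \<longrightarrow> 1 \<le> Ts k \<omega>" for k
  proof (cases "k \<ge> 1")
    case True
    with iid have [measurable]: "Ts k \<in> measurable M (count_space UNIV)"
      by (auto simp: iid_copies_def indep_vars_def)
    have "AE y in distr M (count_space UNIV) T. 1 \<le> y"
      using pos by (subst AE_distr_iff) auto
    moreover have "distr M (count_space UNIV) (Ts k) = distr M (count_space UNIV) T"
      using True iid by (simp add: iid_copies_def)
    ultimately have "AE y in distr M (count_space UNIV) (Ts k). 1 \<le> y" by (simp only:)
    then show ?thesis by (subst (asm) AE_distr_iff) auto
  qed simp
  then show ?thesis unfolding AE_all_countable by auto
qed

text \<open>The integrand is compared with the supermartingale after \<open>n\<close> steps. Steps
  of size at least 1 bring the process to \<open>n\<close> or beyond by then, so the remaining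
  weight is \<open>w 0 = 1\<close>.\<close>

lemma nn_integral_prod_renewal_le:
  fixes T :: "'a \<Rightarrow> nat" and a w :: "nat \<Rightarrow> real"
  assumes meas [measurable]: "T \<in> measurable M (count_space UNIV)"
    and pos: "\<And>\<omega>. \<omega> \<in> space M \<Longrightarrow> T \<omega> \<ge> 1"
    and iid: "iid_copies M {1..} Ts T"
    and a: "\<And>n. 0 \<le> a n" "\<And>n. a n \<le> 1" "a 0 = 1"
    and w: "w 0 = 1" "\<And>n. 0 \<le> w n" "\<And>n. w n \<le> 1"
    and super: "\<And>n. a n * expectation (\<lambda>\<omega>. w (n - T \<omega>)) \<le> w n"
    and n: "n \<ge> 1"
  shows "(\<integral>\<^sup>+\<omega>. ennreal (\<Prod>i\<in>{i. i < n \<and> renewal Ts i \<omega> = 1}. a (n - i)) \<partial>M) \<le> ennreal (w n)"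
proof -
  define S where "S k x = (\<Sum>i=1..k. x i)" for k and x :: "nat \<Rightarrow> nat"
  define Z where "Z x = ennreal ((\<Prod>k<n. a (n - S k x)) * w (n - S n x))" for x
  define X where "X \<omega> = (\<lambda>i\<in>{1..n}. Ts i \<omega>)" for \<omega>
  have [measurable]: "Ts k \<in> measurable M (count_space UNIV)" if "k \<ge> 1" for k
    using iid that by (auto simp: iid_copies_def indep_vars_def)
  have Xm: "X \<in> M \<rightarrow>\<^sub>M Pi\<^sub>M {1..n} (\<lambda>_. count_space UNIV)"
    unfolding X_def by (intro measurable_restrict) auto
  have ge1: "AE \<omega> in M. \<forall>k\<ge>1. 1 \<le> Ts k \<omega>"
    by (rule AE_iid_copies_ge_1[OF meas _ iid]) (rule pos)
  have "AE \<omega> in M. ennreal (\<Prod>i\<in>{i. i < n \<and> renewal Ts i \<omega> = 1}. a (n - i)) \<le> Z (X \<omega>)"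
    using ge1
  proof eventually_elim
    case (elim \<omega>)
    define s where "s k = (\<Sum>i=1..k. Ts i \<omega>)" for k
    have SX: "S k (X \<omega>) = s k" if "k \<le> n" for k
      unfolding S_def X_def s_def using that by (intro sum.cong) auto
    have mono: "strict_mono s"
      unfolding strict_mono_Suc_iff
    proof
      fix k
      have "1 \<le> Ts (Suc k) \<omega>" using elim by simp
      then show "s k < s (Suc k)" by (simp add: s_def)
    qed
    then have ge: "k \<le> s k" for k by (rule strict_mono_imp_increasing)
    let ?K = "{k. k < n \<and> s k < n}"
    have sub: "s ` ?K \<subseteq> {i. i < n \<and> renewal Ts i \<omega> = 1}"
    proof safe
      fix k
      show "renewal Ts (s k) \<omega> = 1"
        by (cases "k = 0") (auto simp: renewal_def s_def intro: exI[of _ k])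
    qed
    \<comment> \<open>One inclusion suffices: any further factors are at most 1 and only lower the
      left side.\<close>
    have "(\<Prod>i\<in>{i. i < n \<and> renewal Ts i \<omega> = 1}. a (n - i)) \<le> (\<Prod>i\<in>s ` ?K. a (n - i))"
      using a by (subst prod.subset_diff[OF sub])
        (auto intro!: mult_left_le_one_le prod_nonneg prod_le_1)
    also have "\<dots> = (\<Prod>k\<in>?K. a (n - s k))"
      using mono by (subst prod.reindex) (auto simp: strict_mono_eq inj_on_def)
    \<comment> \<open>Partial sums at or past \<open>n\<close> contribute \<open>a 0 = 1\<close> by
      truncated subtraction.\<close>
    also have "\<dots> = (\<Prod>k<n. a (n - s k))"
      using a(3) by (intro prod.mono_neutral_left) (auto, metis diff_is_0_eq' linorder_not_le)
    also have "\<dots> = (\<Prod>k<n. a (n - S k (X \<omega>))) * w (n - S n (X \<omega>))"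
      using ge[of n] w by (simp add: SX)
    finally show ?case unfolding Z_def by (rule ennreal_leI)
  qed
  then have "(\<integral>\<^sup>+\<omega>. ennreal (\<Prod>i\<in>{i. i < n \<and> renewal Ts i \<omega> = 1}. a (n - i)) \<partial>M)
    \<le> (\<integral>\<^sup>+\<omega>. Z (X \<omega>) \<partial>M)"
    by (rule nn_integral_mono_AE)
  also have "\<dots> = (\<integral>\<^sup>+x. Z x \<partial>distr M (Pi\<^sub>M {1..n} (\<lambda>_. count_space UNIV)) X)"
    using Xm measurable_PiM_count_space_nat[of "{1..n}" Z] by (simp add: nn_integral_distr)
  also have "\<dots> = (\<integral>\<^sup>+x. Z x \<partial>Pi\<^sub>M {1..n} (\<lambda>_. distr M (count_space UNIV) T))"
    unfolding X_def using n by (subst distr_restrict_eq_PiM_iid[OF iid]) auto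
  also have "\<dots> \<le> ennreal (w n)"
    unfolding Z_def S_def using nn_integral_renewal_supermartingale[OF meas a(1) w(2,3) super] .
  finally show ?thesis .
qed

section \<open>Independent marks on a random set of points\<close>

lemma prob_iid_copies_eq:
  assumes iid: "iid_copies M I Xs X" and i: "i \<in> I" and X: "X \<in> measurable M (count_space UNIV)"
  shows "\<P>(\<omega> in M. Xs i \<omega> \<in> A) = \<P>(\<omega> in M. X \<omega> \<in> A)"
proof -
  have Xs: "Xs i \<in> measurable M (count_space UNIV)"
    using iid i by (auto simp: iid_copies_def indep_vars_def)
  have "measure (distr M (count_space UNIV) (Xs i)) A = measure (distr M (count_space UNIV) X) A"
    using iid i by (simp add: iid_copies_def)
  then have "prob (Xs i -` A \<inter> space M) = prob (X -` A \<inter> space M)"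
    using X Xs by (simp add: measure_distr)
  moreover have "Y -` A \<inter> space M = {\<omega> \<in> space M. Y \<omega> \<in> A}" for Y by blast
  ultimately show ?thesis by simp
qed

text \<open>Conditioning on \<open>\<xi>\<close> in elementary form: its points in \<open>J\<close>
  form one of finitely many patterns \<open>P\<close>. On each pattern, independence of
  \<open>\<xi>\<close> and \<open>Rs\<close> splits the probability, and independence of the marks
  makes the second factor a product. Summing over patterns restores the integral.\<close>

lemma emeasure_all_marks_in:
  fixes \<xi> Rs :: "nat \<Rightarrow> 'a \<Rightarrow> nat" and R :: "'a \<Rightarrow> nat"
  assumes meas [measurable]: "R \<in> measurable M (count_space UNIV)"
    and iid: "iid_copies M UNIV Rs R"
    and ind: "indep_var (PiM UNIV (\<lambda>_. count_space UNIV)) (\<lambda>\<omega> i. \<xi> i \<omega>)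
      (PiM UNIV (\<lambda>_. count_space UNIV)) (\<lambda>\<omega> i. Rs i \<omega>)"
    and J: "finite J"
  shows "emeasure M {\<omega> \<in> space M. \<forall>i\<in>J. \<xi> i \<omega> = 1 \<longrightarrow> Rs i \<omega> \<in> A i}
    = (\<integral>\<^sup>+\<omega>. ennreal (\<Prod>i\<in>{i \<in> J. \<xi> i \<omega> = 1}. \<P>(\<omega> in M. R \<omega> \<in> A i)) \<partial>M)"
proof -
  let ?P = "PiM UNIV (\<lambda>_::nat. count_space (UNIV :: nat set))"
  define b where "b i = \<P>(\<omega> in M. R \<omega> \<in> A i)" for i
  define E where "E P = {\<omega> \<in> space M. {i \<in> J. \<xi> i \<omega> = 1} = P}" for P
  define G where "G P = {\<omega> \<in> space M. \<forall>i\<in>P. Rs i \<omega> \<in> A i}" for P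
  have xi [measurable]: "(\<lambda>\<omega> i. \<xi> i \<omega>) \<in> M \<rightarrow>\<^sub>M ?P"
    using ind by (rule indep_var_rv1)
  have G_prob: "prob (G P) = (\<Prod>i\<in>P. b i)" if "P \<subseteq> J" for P
  \<comment> \<open>The empty pattern is separate because an empty intersection is
    \<open>UNIV\<close> rather than \<open>space M\<close>.\<close>
  proof (cases "P = {}")
    case True
    then show ?thesis by (simp add: G_def prob_space)
  next
    case False
    have b: "prob (Rs i -` A i \<inter> space M) = b i" for i
    proof -
      have "Rs i -` A i \<inter> space M = {\<omega> \<in> space M. Rs i \<omega> \<in> A i}" by blast
      then show ?thesis using prob_iid_copies_eq[OF iid UNIV_I meas] by (simp only: b_def)
    qed
    have "G P = (\<Inter>i\<in>P. Rs i -` A i \<inter> space M)"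
      using False by (auto simp: G_def)
    moreover have "finite P" using that J by (rule finite_subset)
    ultimately show ?thesis
      using indep_varsD[of "\<lambda>_. count_space UNIV" Rs UNIV P A] iid False
      by (simp add: b iid_copies_def)
  qed
  have sets_E: "{x. {i \<in> J. x i = 1} = P} \<in> sets ?P" for P
    using J by (rule sets_PiM_finite_pattern)
  have sets_G: "{x. \<forall>i\<in>P. x i \<in> A i} \<in> sets ?P" if "P \<subseteq> J" for P
    using finite_subset[OF that J] by (rule sets_PiM_finite_cylinder)
  have [measurable]: "E P \<in> sets M" for P
  proof -
    have "E P = (\<lambda>\<omega> i. \<xi> i \<omega>) -` {x. {i \<in> J. x i = 1} = P} \<inter> space M"
      unfolding E_def by blast
    then show ?thesis using measurable_sets[OF xi sets_E[of P]] by (simp only:)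
  qed
  have [measurable]: "G P \<in> sets M" if "P \<subseteq> J" for P
  proof -
    have "G P = (\<lambda>\<omega> i. Rs i \<omega>) -` {x. \<forall>i\<in>P. x i \<in> A i} \<inter> space M"
      unfolding G_def by blast
    then show ?thesis
      using measurable_sets[OF indep_var_rv2[OF ind] sets_G[OF that]] by (simp only:)
  qed
  have EG: "prob (E P \<inter> G P) = prob (E P) * (\<Prod>i\<in>P. b i)" if "P \<subseteq> J" for P
  proof -
    have "prob ((\<lambda>\<omega>. (\<lambda>i. \<xi> i \<omega>, \<lambda>i. Rs i \<omega>)) -`
          ({x. {i \<in> J. x i = 1} = P} \<times> {x. \<forall>i\<in>P. x i \<in> A i}) \<inter> space M)
        = prob ((\<lambda>\<omega> i. \<xi> i \<omega>) -` {x. {i \<in> J. x i = 1} = P} \<inter> space M)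
        * prob ((\<lambda>\<omega> i. Rs i \<omega>) -` {x. \<forall>i\<in>P. x i \<in> A i} \<inter> space M)"
      by (rule indep_varD[OF ind sets_E sets_G[OF that]])
    also have "(\<lambda>\<omega>. (\<lambda>i. \<xi> i \<omega>, \<lambda>i. Rs i \<omega>)) -`
          ({x. {i \<in> J. x i = 1} = P} \<times> {x. \<forall>i\<in>P. x i \<in> A i}) \<inter> space M = E P \<inter> G P"
      by (auto simp: E_def G_def)
    also have "(\<lambda>\<omega> i. \<xi> i \<omega>) -` {x. {i \<in> J. x i = 1} = P} \<inter> space M = E P"
      by (auto simp: E_def)
    also have "(\<lambda>\<omega> i. Rs i \<omega>) -` {x. \<forall>i\<in>P. x i \<in> A i} \<inter> space M = G P"
      by (auto simp: G_def)
    finally show ?thesis using G_prob[OF that] by simp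
  qed
  have b0: "0 \<le> (\<Prod>i\<in>P. b i)" for P by (intro prod_nonneg) (simp add: b_def)
  have "{\<omega> \<in> space M. \<forall>i\<in>J. \<xi> i \<omega> = 1 \<longrightarrow> Rs i \<omega> \<in> A i} = (\<Union>P\<in>Pow J. E P \<inter> G P)"
    (is "?L = ?U")
  proof (intro subset_antisym subsetI)
    fix \<omega> assume "\<omega> \<in> ?L"
    then have "\<omega> \<in> E {i \<in> J. \<xi> i \<omega> = 1} \<inter> G {i \<in> J. \<xi> i \<omega> = 1}"
      by (simp add: E_def G_def)
    then show "\<omega> \<in> ?U" by (rule UN_I[rotated]) blast
  next
    fix \<omega> assume "\<omega> \<in> ?U"
    then obtain P where P: "\<omega> \<in> E P" "\<omega> \<in> G P" by blast
    then have "P = {i \<in> J. \<xi> i \<omega> = 1}" by (simp add: E_def)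
    with P(2) show "\<omega> \<in> ?L" by (simp add: G_def)
  qed
  moreover have "disjoint_family_on (\<lambda>P. E P \<inter> G P) (Pow J)"
    by (auto simp: disjoint_family_on_def E_def)
  ultimately have "emeasure M {\<omega> \<in> space M. \<forall>i\<in>J. \<xi> i \<omega> = 1 \<longrightarrow> Rs i \<omega> \<in> A i}
     = (\<Sum>P\<in>Pow J. emeasure M (E P \<inter> G P))"
    using J by (subst sum_emeasure) auto
  also have "\<dots> = (\<Sum>P\<in>Pow J. ennreal (\<Prod>i\<in>P. b i) * emeasure M (E P))"
    using b0 by (intro sum.cong) (auto simp: emeasure_eq_measure EG ennreal_mult'[symmetric] mult.commute)
  also have "\<dots> = (\<Sum>P\<in>Pow J. \<integral>\<^sup>+\<omega>. ennreal (\<Prod>i\<in>P. b i) * indicator (E P) \<omega> \<partial>M)"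
    by (simp add: nn_integral_cmult_indicator)
  also have "\<dots> = (\<integral>\<^sup>+\<omega>. (\<Sum>P\<in>Pow J. ennreal (\<Prod>i\<in>P. b i) * indicator (E P) \<omega>) \<partial>M)"
    by (intro nn_integral_sum[symmetric]) auto
  also have "\<dots> = (\<integral>\<^sup>+\<omega>. ennreal (\<Prod>i\<in>{i \<in> J. \<xi> i \<omega> = 1}. b i) \<partial>M)"
  proof (rule nn_integral_cong)
    fix \<omega> assume \<omega>: "\<omega> \<in> space M"
    \<comment> \<open>For each outcome exactly one pattern has a nonzero indicator.\<close>
    have "(\<Sum>P\<in>Pow J. ennreal (\<Prod>i\<in>P. b i) * indicator (E P) \<omega>)
      = (\<Sum>P\<in>Pow J. if P = {i \<in> J. \<xi> i \<omega> = 1} then ennreal (\<Prod>i\<in>P. b i) else 0)"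
      using \<omega> by (intro sum.cong) (auto simp: E_def indicator_def)
    also have "\<dots> = ennreal (\<Prod>i\<in>{i \<in> J. \<xi> i \<omega> = 1}. b i)"
      using J by (subst sum.delta) auto
    finally show "(\<Sum>P\<in>Pow J. ennreal (\<Prod>i\<in>P. b i) * indicator (E P) \<omega>)
      = ennreal (\<Prod>i\<in>{i \<in> J. \<xi> i \<omega> = 1}. b i)" .
  qed
  finally show ?thesis unfolding b_def .
qed

end

section \<open>Positive probability of coverage\<close>

theorem proposition3:
  fixes M :: "'a measure"
    and T R :: "'a \<Rightarrow> nat"
    and Ts Rs :: "nat \<Rightarrow> 'a \<Rightarrow> nat"
    and \<alpha> :: "nat \<Rightarrow> real"
  assumes "prob_space M"
    and "T \<in> measurable M (count_space UNIV)"
    and "\<And>\<omega>. \<omega> \<in> space M \<Longrightarrow> T \<omega> \<ge> 1"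
    and "integrable M (\<lambda>\<omega>. real (T \<omega>))"
    and "Gcd {k. k \<ge> 1 \<and> \<P>(\<omega> in M. T \<omega> = k) > 0} = 1"
    and "iid_copies M {1..} Ts T"
    and "R \<in> measurable M (count_space UNIV)"
    and "\<P>(\<omega> in M. R \<omega> = 0) > 0"
    and "iid_copies M UNIV Rs R"
    and "prob_space.indep_var M
           (PiM UNIV (\<lambda>_. count_space UNIV)) (\<lambda>\<omega> i. renewal Ts i \<omega>)
           (PiM UNIV (\<lambda>_. count_space UNIV)) (\<lambda>\<omega> i. Rs i \<omega>)"
    and "\<And>n. \<alpha> n = \<P>(\<omega> in M. R \<omega> \<le> n)"
    and "(\<lambda>k. \<Sum>j=1..k. \<Prod>i=k..k + j - 2. q_star M T i) \<in> o(\<lambda>k. real k)"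
    and "liminf (\<lambda>n. ereal (real n * inverse (LINT \<omega>|M. real (T \<omega>)) * (1 - \<alpha> n))) > 1"
  shows "measure M (coverage_event M (renewal Ts) Rs) > 0"
proof -
  interpret prob_space M by fact
  note [measurable] = assms(2,7)
  note \<alpha> = assms(11)
  define \<mu> where "\<mu> = expectation (\<lambda>\<omega>. real (T \<omega>))"
  have "expectation (\<lambda>\<omega>. 1) \<le> \<mu>"
    unfolding \<mu>_def using assms(3,4) by (intro integral_mono) auto
  then have \<mu>: "0 < \<mu>" by (simp add: prob_space)
  obtain C where C: "\<And>n. n \<ge> 1 \<Longrightarrow> \<P>(\<omega> in M. T \<omega> \<ge> n) \<le> C / real n ^ 3"
    using cubic_tail_decay[OF assms(2,3,12)] by blast
  have \<alpha>_mono: "\<alpha> m \<le> \<alpha> n" if "m \<le> n" for m n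
    unfolding \<alpha> using that by (intro finite_measure_mono) auto
  have \<alpha>01: "0 \<le> \<alpha> n" "\<alpha> n \<le> 1" for n by (simp_all add: \<alpha>)
  have \<alpha>0: "0 < \<alpha> 0" using assms(8) by (simp add: \<alpha>)
  \<comment> \<open>A constant strictly between 1 and the liminf turns the hypothesis into an
    eventual inequality.\<close>
  obtain c where c: "1 < c"
    "ereal c < liminf (\<lambda>n. ereal (real n * inverse (LINT \<omega>|M. real (T \<omega>)) * (1 - \<alpha> n)))"
    using ereal_dense2[OF assms(13)] by auto
  have "\<forall>\<^sub>F n in sequentially. c < real n * inverse \<mu> * (1 - \<alpha> n)"
    using less_LiminfD[OF c(2)] by (simp add: \<mu>_def)
  then have \<alpha>_le: "\<forall>\<^sub>F n in sequentially. \<alpha> n \<le> 1 - c * \<mu> / real n \<and> \<alpha> n < 1"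
    using eventually_ge_at_top[of 1]
  proof eventually_elim
    case (elim n)
    then have "c * \<mu> / real n < 1 - \<alpha> n" using \<mu> by (simp add: field_simps)
    moreover have "0 \<le> c * \<mu> / real n" using c \<mu> by simp
    ultimately show ?case by linarith
  qed
  \<comment> \<open>Monotonicity carries the eventual strict bound back to every \<open>n\<close>;
    thus a mark exceeds any level with positive probability.\<close>
  have \<alpha>_less_1: "\<alpha> n < 1" for n
  proof -
    have "\<forall>\<^sub>F m in sequentially. \<alpha> m < 1 \<and> n \<le> m"
      using \<alpha>_le eventually_ge_at_top[of n] by eventually_elim auto
    then obtain m where "\<alpha> m < 1" "n \<le> m"
      using eventually_happens'[OF sequentially_bot] by blast
    then show ?thesis using \<alpha>_mono[of n m] by simp
  qed
  \<comment> \<open>Origin \<open>i\<close> misses the point \<open>n\<close> when its mark is at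
    most \<open>n - i - 1\<close>, hence the shift. The value \<open>a 0 = 1\<close> neutralises
    renewals at or past \<open>n\<close>.\<close>
  define a where "a n = (if n = 0 then 1 else \<alpha> (n - 1))" for n
  have a: "0 \<le> a n" "a n \<le> 1" "a 0 = 1" for n by (auto simp: a_def \<alpha>01)
  have a_le: "\<forall>\<^sub>F n in sequentially. a n \<le> 1 - c * \<mu> / real n"
    using \<alpha>_le eventually_ge_at_top[of 1]
  proof eventually_elim
    case (elim n)
    then show ?case using \<alpha>_mono[of "n - 1" n] by (simp add: a_def)
  qed
  obtain w where w: "w 0 = 1" "\<And>n. 0 \<le> w n" "\<And>n. w n \<le> 1" "summable w"
      and super: "\<And>n. a n * expectation (\<lambda>\<omega>. w (n - T \<omega>)) \<le> w n"
    using renewal_supersolution[OF assms(2,4) \<mu>[unfolded \<mu>_def] C a(1,2) c(1) a_le[unfolded \<mu>_def]] by blast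
  have xi [measurable]: "renewal Ts i \<in> measurable M (count_space UNIV)" for i
    using measurable_compose[OF indep_var_rv1[OF assms(10)] measurable_component_singleton[of i]]
    by simp
  define b where "b K = \<P>(\<omega> in M. K \<le> R \<omega>)" for K
  have b: "0 < b K" if "K \<ge> 1" for K
  proof -
    have "b K = prob (space M - {\<omega> \<in> space M. R \<omega> \<le> K - 1})"
      unfolding b_def using that by (intro arg_cong[where f = prob]) auto
    also have "\<dots> = 1 - \<alpha> (K - 1)" by (simp add: prob_compl \<alpha>)
    finally show ?thesis using \<alpha>_less_1[of "K - 1"] by simp
  qed
  \<comment> \<open>No origin strictly between 0 and \<open>n\<close> reaches \<open>n\<close>.
    Keeping the demand on the mark of origin 0 inside the event leaves a factor \<open>b K\<close>
    in its probability, which cancels in the union bound.\<close>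
  define U where "U K n = {\<omega> \<in> space M. K \<le> Rs 0 \<omega> \<and>
    (\<forall>i\<in>{1..<n}. renewal Ts i \<omega> = 1 \<longrightarrow> Rs i \<omega> < n - i)}" for K n
  have U: "prob (U K n) \<le> b K / \<alpha> 0 * w n" if n: "n \<ge> 1" for K n
  proof -
    \<comment> \<open>Since 0 is always a renewal, the demand \<open>K \<le> Rs 0 \<omega>\<close>
      can be coded as the mark constraint at 0, in place of missing \<open>n\<close>.\<close>
    define A where "A i = (if i = 0 then {K..} else {..<n - i})" for i
    have *: "{..<n} = insert 0 {1..<n}" using n by auto
    have "U K n = {\<omega> \<in> space M. \<forall>i\<in>{..<n}. renewal Ts i \<omega> = 1 \<longrightarrow> Rs i \<omega> \<in> A i}"
      unfolding * by (simp add: U_def A_def renewal_def)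
    then have "emeasure M (U K n) =
        (\<integral>\<^sup>+\<omega>. ennreal (\<Prod>i\<in>{i \<in> {..<n}. renewal Ts i \<omega> = 1}. \<P>(\<omega> in M. R \<omega> \<in> A i)) \<partial>M)"
      using emeasure_all_marks_in[OF assms(7,9,10), of "{..<n}" A] by simp
    also have "\<dots> \<le> (\<integral>\<^sup>+\<omega>. ennreal (b K / \<alpha> 0) *
        ennreal (\<Prod>i\<in>{i. i < n \<and> renewal Ts i \<omega> = 1}. a (n - i)) \<partial>M)"
    proof (rule nn_integral_mono)
      fix \<omega>
      define I where "I = {i. i < n \<and> renewal Ts i \<omega> = 1}"
      have I: "finite I" "0 \<in> I" "{i \<in> {..<n}. renewal Ts i \<omega> = 1} = I"
        using n by (auto simp: I_def renewal_def)
      define p where "p = (\<Prod>i\<in>I - {0}. a (n - i))"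
      have p: "0 \<le> p" unfolding p_def using a by (intro prod_nonneg) auto
      have "\<P>(\<omega> in M. R \<omega> \<in> A i) = a (n - i)" if "i \<in> I - {0}" for i
      proof -
        have "{\<omega> \<in> space M. R \<omega> \<in> A i} = {\<omega> \<in> space M. R \<omega> \<le> n - i - 1}"
          using that by (auto simp: A_def I_def)
        then show ?thesis using that by (simp add: \<alpha> a_def I_def)
      qed
      then have "(\<Prod>i\<in>I. \<P>(\<omega> in M. R \<omega> \<in> A i)) = b K * p"
        using I by (simp add: prod.remove[of I 0] p_def A_def b_def)
      moreover have "(\<Prod>i\<in>I. a (n - i)) = a n * p"
        using I by (simp add: prod.remove[of I 0] p_def)
      \<comment> \<open>Exchanging the factor \<open>a n\<close> of origin 0 for \<open>b K\<close>
        costs at most \<open>1 / \<alpha> 0\<close>; this is where \<open>P (R = 0) > 0\<close>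
        enters.\<close>
      moreover have "b K * p \<le> b K / \<alpha> 0 * (a n * p)"
      proof -
        have "\<alpha> 0 \<le> a n" using n \<alpha>_mono by (simp add: a_def)
        then have "\<alpha> 0 * (b K * p) \<le> a n * (b K * p)"
          using p by (intro mult_right_mono) (auto simp: b_def)
        then show ?thesis using \<alpha>0 by (simp add: field_simps)
      qed
      ultimately show "ennreal (\<Prod>i\<in>{i \<in> {..<n}. renewal Ts i \<omega> = 1}. \<P>(\<omega> in M. R \<omega> \<in> A i))
        \<le> ennreal (b K / \<alpha> 0) * ennreal (\<Prod>i\<in>{i. i < n \<and> renewal Ts i \<omega> = 1}. a (n - i))"
        using p a(1)[of n] \<alpha>0 unfolding I(3) I_def[symmetric]
        by (simp add: ennreal_mult'[symmetric] b_def ennreal_leI)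
    qed
    also have "\<dots> \<le> ennreal (b K / \<alpha> 0) * ennreal (w n)"
    proof -
      have "(\<Prod>i\<in>{i. i < n \<and> renewal Ts i \<omega> = 1}. a (n - i))
          = (\<Prod>i<n. if renewal Ts i \<omega> = 1 then a (n - i) else 1)" for \<omega>
        by (simp add: prod.inter_filter[symmetric])
      then have "(\<lambda>\<omega>. ennreal (\<Prod>i\<in>{i. i < n \<and> renewal Ts i \<omega> = 1}. a (n - i))) \<in> borel_measurable M"
        by simp
      then show ?thesis
        using nn_integral_prod_renewal_le[OF assms(2,3,6) a w(1,2,3) super n]
        by (simp add: nn_integral_cmult mult_left_mono)
    qed
    finally show ?thesis
      using \<alpha>0 w by (simp add: emeasure_eq_measure ennreal_mult'[symmetric] b_def)
  qed
  have [measurable]: "Rs i \<in> measurable M (count_space UNIV)" for i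
    using assms(9) by (auto simp: iid_copies_def indep_vars_def)
  have [measurable]: "U K n \<in> sets M" for K n
    unfolding U_def by measurable
  \<comment> \<open>The threshold \<open>\<alpha> 0\<close> does not involve \<open>K\<close>, so
    \<open>K\<close> can be fixed afterwards: the union bound is \<open>b K / \<alpha> 0\<close>
    times a tail of \<open>w\<close>, hence below \<open>b K\<close>.\<close>
  obtain N where N: "\<And>n. n \<ge> N \<Longrightarrow> norm (\<Sum>i. w (i + n)) < \<alpha> 0"
    using suminf_exist_split[OF \<alpha>0 w(4)] by blast
  define K where "K = max N 1"
  have K: "K \<ge> 1" "N \<le> Suc K" by (auto simp: K_def)
  have w_tail: "(\<Sum>i. w (i + Suc K)) < \<alpha> 0"
    using N[OF K(2)] by (simp only: real_norm_def)
  have sw: "summable (\<lambda>i. b K / \<alpha> 0 * w (i + Suc K))"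
    using w(4) by (intro summable_mult) (subst summable_iff_shift)
  have sU: "summable (\<lambda>i. prob (U K (i + Suc K)))"
    by (rule summable_comparison_test[OF _ sw]) (use U in auto)
  have "prob (\<Union>i. U K (i + Suc K)) \<le> (\<Sum>i. prob (U K (i + Suc K)))"
    by (intro finite_measure_subadditive_countably sU) auto
  also have "\<dots> \<le> (\<Sum>i. b K / \<alpha> 0 * w (i + Suc K))"
    by (intro suminf_le sU sw U) auto
  also have "\<dots> = b K / \<alpha> 0 * (\<Sum>i. w (i + Suc K))"
    using w(4) by (intro suminf_mult) (subst summable_iff_shift)
  also have "\<dots> < b K / \<alpha> 0 * \<alpha> 0"
    using w_tail b[OF K(1)] \<alpha>0 by (intro mult_strict_left_mono) auto
  also have "\<dots> = b K" using \<alpha>0 by simp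
  finally have lt: "prob (\<Union>i. U K (i + Suc K)) < b K" .
  let ?B = "{\<omega> \<in> space M. K \<le> Rs 0 \<omega>}"
  have "b K = prob ?B"
    using prob_iid_copies_eq[OF assms(9) UNIV_I assms(7), of 0 "{K..}"] by (simp add: b_def)
  then have "0 < prob ?B - prob (\<Union>i. U K (i + Suc K))" using lt by simp
  also have "\<dots> = prob (?B - (\<Union>i. U K (i + Suc K)))"
    by (intro finite_measure_Diff[symmetric]) (auto simp: U_def)
  also have "\<dots> \<le> prob (coverage_event M (renewal Ts) Rs)"
  proof (rule finite_measure_mono)
    \<comment> \<open>Rewriting coverage with countable quantifiers makes its measurability
      evident.\<close>
    have cov: "(\<Union>i. covered (renewal Ts) Rs i \<omega>) = {1..} \<longleftrightarrow>
        (\<forall>m\<ge>1. \<exists>i<m. renewal Ts i \<omega> = 1 \<and> m \<le> i + Rs i \<omega>)" for \<omega>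
    proof -
      have "m \<in> covered (renewal Ts) Rs i \<omega> \<longleftrightarrow> i < m \<and> renewal Ts i \<omega> = 1 \<and> m \<le> i + Rs i \<omega>" for i m
        by (auto simp: covered_def)
      then have "(\<Union>i. covered (renewal Ts) Rs i \<omega>) = {m. \<exists>i<m. renewal Ts i \<omega> = 1 \<and> m \<le> i + Rs i \<omega>}"
        by auto
      then show ?thesis by (auto simp: set_eq_iff Suc_le_eq)
    qed
    show "coverage_event M (renewal Ts) Rs \<in> sets M"
      unfolding coverage_event_def cov by measurable
    \<comment> \<open>Origin 0 covers the points up to \<open>K\<close>. For \<open>m > K\<close>
      its mark is still at least \<open>K\<close>, so failure of \<open>U K m\<close> must come from
      another origin that reaches \<open>m\<close>.\<close>
    show "?B - (\<Union>i. U K (i + Suc K)) \<subseteq> coverage_event M (renewal Ts) Rs"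
    proof
      fix \<omega> assume "\<omega> \<in> ?B - (\<Union>i. U K (i + Suc K))"
      then have \<omega>: "\<omega> \<in> space M" "K \<le> Rs 0 \<omega>" "\<And>i. \<omega> \<notin> U K (i + Suc K)" by auto
      have "\<exists>i<m. renewal Ts i \<omega> = 1 \<and> m \<le> i + Rs i \<omega>" if "m \<ge> 1" for m
      proof (cases "m \<le> K")
        case True
        then show ?thesis using \<omega> that by (intro exI[of _ 0]) (auto simp: renewal_def)
      next
        case False
        then have "\<omega> \<notin> U K m" using \<omega>(3)[of "m - Suc K"] by simp
        then obtain i where "i \<in> {1..<m}" "renewal Ts i \<omega> = 1" "\<not> Rs i \<omega> < m - i"
          using \<omega> by (auto simp: U_def)
        then show ?thesis by (intro exI[of _ i]) auto
      qed
      then show "\<omega> \<in> coverage_event M (renewal Ts) Rs"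
        unfolding coverage_event_def cov using \<omega>(1) by blast
    qed
  qed
  finally show ?thesis .
qed

end
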